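(* For $n\ge1$, the number of permutations in $S_n$ equivalent to the identity $\iota_n=12\cdots n$ under adjacent $\{\{123,213\}\}$-equivalence is $\lfloor n/2\rfloor!\,\lceil n/2\rceil!$.
   Context: Permutations are written as words $\pi_1\cdots\pi_n$. A sequence of distinct integers $a_1a_2a_3$ has pattern $\sigma\in S_3$ if $a_s<a_t\iff\sigma_s<\sigma_t$. An adjacent move on $\pi\in S_n$ chooses three consecutive positions $i,i+1,i+2$ with $\pi_i\pi_{i+1}\pi_{i+2}$ of pattern $123$ or $213$ and rearranges these three values in these positions to have the other of these two patterns (i.e., swaps $\pi_i,\pi_{i+1}$ when both are smaller than $\pi_{i+2}$). Equivalence is the equivalence relation generated by such moves. *)

theory Defs
  imports Complex_Main "HOL-Combinatorics.Multiset_Permutations"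
begin

text \<open>Permutations of \<open>{1..n}\<close> are words, i.e. elements of \<^term>\<open>permutations_of_set {1..n}\<close>.\<close>

definition has_pattern :: "nat list \<Rightarrow> nat list \<Rightarrow> bool" where
  "has_pattern a \<sigma> \<longleftrightarrow> length a = length \<sigma> \<and> distinct a \<and>
     (\<forall>s < length \<sigma>. \<forall>t < length \<sigma>. a ! s < a ! t \<longleftrightarrow> \<sigma> ! s < \<sigma> ! t)"

text \<open>
  A factor (block of consecutive letters) \<open>a\<close> whose pattern lies in a block \<open>C\<close> of \<open>P\<close> is replaced,
  in the same positions, by a rearrangement \<open>b\<close> of its letters with a different pattern from \<open>C\<close>.
\<close>

definition adjacent_move :: "nat list set set \<Rightarrow> nat list \<Rightarrow> nat list \<Rightarrow> bool" where
  "adjacent_move P \<pi> \<tau> \<longleftrightarrow>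
     (\<exists>C \<in> P. \<exists>\<alpha> \<in> C. \<exists>\<beta> \<in> C. \<alpha> \<noteq> \<beta> \<and>
       (\<exists>u a b v. \<pi> = u @ a @ v \<and> \<tau> = u @ b @ v \<and> mset b = mset a \<and>
          has_pattern a \<alpha> \<and> has_pattern b \<beta>))"

definition adjacent_equiv :: "nat list set set \<Rightarrow> nat list \<Rightarrow> nat list \<Rightarrow> bool" where
  "adjacent_equiv P = equivclp (adjacent_move P)"

end

theory Submission
  imports Defs
begin

text \<open>
  The class of the identity consists of the words in which a letter followed by \<open>k\<close> further
  letters always has at least \<open>k / 2\<close> larger letters to its right. A move preserves this property: if \<open>a, b < c\<close>
  and \<open>c\<close> heads a suffix with the property, then the conditions on \<open>a\<close> and \<open>b\<close> hold in either order.
  Conversely, such a word \<open>x w\<close> can be sorted: inductively \<open>w\<close> is equivalent to \<open>s c r\<close>, where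
  \<open>s\<close> is its least letter, \<open>c\<close> the least letter above \<open>x\<close>, and \<open>r\<close> is increasing; if \<open>s < x\<close>,
  the move \<open>x s c \<rightarrow> s x c\<close> brings the least letter to the front, and \<open>x c r\<close> is sorted inductively.
  The first letter of such a word of length \<open>k\<close> can be chosen in \<open>\<lceil>k / 2\<rceil>\<close> ways, independently of
  the relative order of the rest.
\<close>

fun half_dominated :: "nat list \<Rightarrow> bool" where
  "half_dominated [] \<longleftrightarrow> True"
| "half_dominated (x # w) \<longleftrightarrow> length w \<le> 2 * card {y \<in> set w. x < y} \<and> half_dominated w"

section \<open>Moves as swaps of two letters below their right neighbour\<close>

abbreviation move :: "nat list \<Rightarrow> nat list \<Rightarrow> bool" where
  "move \<equiv> adjacent_move {{[1, 2, 3], [2, 1, 3]}}"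

abbreviation move_equiv :: "nat list \<Rightarrow> nat list \<Rightarrow> bool"  (infix "\<approx>" 50) where
  "move_equiv \<equiv> adjacent_equiv {{[1, 2, 3], [2, 1, 3]}}"

lemma has_pattern_123: "has_pattern a [1, 2, 3] \<longleftrightarrow> (\<exists>x y z. a = [x, y, z] \<and> x < y \<and> y < z)"
  by (auto simp: has_pattern_def length_Suc_conv numeral_3_eq_3 less_Suc_eq all_conj_distrib
      nth_Cons split: nat.splits)

lemma has_pattern_213: "has_pattern a [2, 1, 3] \<longleftrightarrow> (\<exists>x y z. a = [x, y, z] \<and> y < x \<and> x < z)"
  by (auto simp: has_pattern_def length_Suc_conv numeral_3_eq_3 less_Suc_eq all_conj_distrib
      nth_Cons split: nat.splits)

text \<open>Both patterns have their largest letter last and differ in the order of the other two,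
  so equal multisets force a swap of the first two letters. Not recording which of \<open>x\<close>
  and \<open>y\<close> is larger treats both directions of a move at once.\<close>

lemma moveE:
  assumes "move \<pi> \<tau>"
  obtains u x y z v where "\<pi> = u @ [x, y, z] @ v" "\<tau> = u @ [y, x, z] @ v" "x < z" "y < z"
proof -
  obtain u a b v where uv: "\<pi> = u @ a @ v" "\<tau> = u @ b @ v" and m: "mset b = mset a"
    and pat: "has_pattern a [1, 2, 3] \<and> has_pattern b [2, 1, 3] \<or>
              has_pattern a [2, 1, 3] \<and> has_pattern b [1, 2, 3]"
    using assms unfolding adjacent_move_def by auto
  have "\<exists>x y z. a = [x, y, z] \<and> b = [y, x, z] \<and> x < z \<and> y < z"
    using pat m unfolding has_pattern_123 has_pattern_213
    by (auto simp: add_eq_conv_ex add_mset_eq_single)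
  with uv that show ?thesis by blast
qed

lemma adjacent_moveI:
  assumes "C \<in> P" "\<alpha> \<in> C" "\<beta> \<in> C" "\<alpha> \<noteq> \<beta>" "mset b = mset a" "has_pattern a \<alpha>" "has_pattern b \<beta>"
  shows "adjacent_move P (u @ a @ v) (u @ b @ v)"
  using assms unfolding adjacent_move_def by blast

lemma moveI:
  assumes "x \<noteq> y" "x < z" "y < z"
  shows "move (u @ [x, y, z] @ v) (u @ [y, x, z] @ v)"
proof (cases "x < y")
  case True
  with assms have "has_pattern [x, y, z] [1, 2, 3]" "has_pattern [y, x, z] [2, 1, 3]"
    unfolding has_pattern_123 has_pattern_213 by auto
  then show ?thesis by (rule adjacent_moveI[rotated 5]) auto
next
  case False
  with assms have "has_pattern [x, y, z] [2, 1, 3]" "has_pattern [y, x, z] [1, 2, 3]"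
    unfolding has_pattern_123 has_pattern_213 by auto
  then show ?thesis by (rule adjacent_moveI[rotated 5]) auto
qed

lemma adjacent_equiv_refl: "adjacent_equiv P w w"
  by (simp add: adjacent_equiv_def)

lemma adjacent_equiv_sym: "adjacent_equiv P v w \<Longrightarrow> adjacent_equiv P w v"
  unfolding adjacent_equiv_def by (rule equivclp_sym)

lemma adjacent_equiv_trans [trans]:
  "adjacent_equiv P u v \<Longrightarrow> adjacent_equiv P v w \<Longrightarrow> adjacent_equiv P u w"
  unfolding adjacent_equiv_def by (rule equivclp_trans)

lemma adjacent_move_imp_equiv: "adjacent_move P v w \<Longrightarrow> adjacent_equiv P v w"
  unfolding adjacent_equiv_def by (rule r_into_equivclp)

lemma adjacent_move_Cons: "adjacent_move P v w \<Longrightarrow> adjacent_move P (x # v) (x # w)"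
  unfolding adjacent_move_def by (metis append_Cons)

lemma adjacent_equiv_Cons:
  assumes "adjacent_equiv P v w"
  shows "adjacent_equiv P (x # v) (x # w)"
  using assms unfolding adjacent_equiv_def
proof (induction rule: equivclp_induct)
  case (step y z)
  then show ?case
    by (metis adjacent_move_Cons equivclp_into_equivclp)
qed simp

section \<open>Invariance of half-domination\<close>

text \<open>Above \<open>a\<close> and \<open>b\<close> lie \<open>c\<close> and every letter above
  \<open>c\<close>, one more than are counted for \<open>c\<close>. Doubled, this gain of one covers
  the at most two further letters to the right.\<close>

lemma half_dominated_head_swap:
  assumes "half_dominated (c # v)" "a < c" "b < c"
  shows "half_dominated (a # b # c # v)"
proof -
  have *: "length v + 2 \<le> 2 * card {y \<in> insert c (set v). x < y}" if "x < c" for x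
  proof -
    have "insert c {y \<in> set v. c < y} \<subseteq> {y \<in> insert c (set v). x < y}"
      using that by auto
    then have "card (insert c {y \<in> set v. c < y}) \<le> card {y \<in> insert c (set v). x < y}"
      by (intro card_mono) auto
    with assms(1) show ?thesis by simp
  qed
  have "card {y \<in> insert c (set v). a < y} \<le> card {y \<in> insert b (insert c (set v)). a < y}"
    by (intro card_mono) auto
  with *[OF assms(2)] *[OF assms(3)] assms(1) show ?thesis by simp
qed

lemma half_dominated_swap:
  assumes "half_dominated (u @ [a, b, c] @ v)" "a < c" "b < c"
  shows "half_dominated (u @ [b, a, c] @ v)"
  using assms
proof (induction u)
  case Nil
  then have "half_dominated (c # v)" by simp
  from half_dominated_head_swap[OF this] Nil show ?case by simp
next
  case (Cons x u)
  \<comment> \<open>The condition on a letter left of the swap depends only on the length and the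
    set of what follows it.\<close>
  have "set (u @ [b, a, c] @ v) = set (u @ [a, b, c] @ v)" by auto
  with Cons show ?case by (auto simp del: set_append)
qed

lemma half_dominated_move: "move v w \<Longrightarrow> half_dominated v \<longleftrightarrow> half_dominated w"
  by (erule moveE) (metis half_dominated_swap)

lemma half_dominated_equiv:
  assumes "v \<approx> w"
  shows "half_dominated v \<longleftrightarrow> half_dominated w"
  using assms unfolding adjacent_equiv_def
  by (induction rule: equivclp_induct) (use half_dominated_move in blast)+

lemma half_dominated_sorted: "sorted_wrt (<) w \<Longrightarrow> half_dominated w"
proof (induction w)
  case (Cons x w)
  then have "{y \<in> set w. x < y} = set w" "distinct w"
    by (auto simp: strict_sorted_iff)
  with Cons show ?case by (simp add: distinct_card)
qed simp

section \<open>Sorting half-dominated words\<close>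

text \<open>The induction is on length because the hypothesis is applied not only to the tail
  \<open>w'\<close> but also to the rearranged words \<open>s # c # r\<close> and
  \<open>x # c # r\<close>, each one letter shorter than \<open>w\<close>.\<close>

lemma equiv_sort:
  assumes "half_dominated w" "distinct w"
  shows "w \<approx> sort w"
  using assms
proof (induction w rule: length_induct)
  case (1 w)
  then have IH: "v \<approx> sort v" if "length v < length w" "half_dominated v" "distinct v" for v
    using that by blast
  show ?case
  proof (cases w)
    case Nil
    then show ?thesis by (simp add: adjacent_equiv_refl)
  next
    case (Cons x w')
    with 1 have dom: "half_dominated w'" and len: "length w' \<le> 2 * card {y \<in> set w'. x < y}"
      and dist: "distinct w'" "x \<notin> set w'"
      by auto
    then have w': "w' \<approx> sort w'" using Cons by (intro IH) auto
    show ?thesis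
    proof (cases "\<forall>y \<in> set w'. x < y")
      case True
      then have "sort w = x # sort w'"
        unfolding Cons by (intro properties_for_sort) auto
      with adjacent_equiv_Cons[OF w', of x] show ?thesis by (simp only: Cons)
    next
      case False
      define s where "s = Min (set w')"
      define c where "c = Min {y \<in> set w'. x < y}"
      define r where "r = sorted_list_of_set (set w' - {s, c})"
      from False have ne: "set w' \<noteq> {}" by auto
      \<comment> \<open>Half of a positive length is positive, so some letter of \<open>w'\<close>
        exceeds \<open>x\<close>.\<close>
      with len have "{y \<in> set w'. x < y} \<noteq> {}"
        by (metis card.empty length_0_conv mult_0_right le_zero_eq set_empty)
      then have c: "c \<in> set w'" "x < c" and c_le: "\<And>y. y \<in> set w' \<Longrightarrow> x < y \<Longrightarrow> c \<le> y"
        unfolding c_def using Min_in[of "{y \<in> set w'. x < y}"] by auto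
      have s: "s \<in> set w'" and s_le: "\<And>y. y \<in> set w' \<Longrightarrow> s \<le> y"
        using ne by (auto simp: s_def)
      from False obtain y where "y \<in> set w'" "y \<le> x" by (auto simp: not_less)
      with dist s_le[of y] have "s < x" by (cases "y = x") auto
      have r: "set r = set w' - {s, c}" "sorted_wrt (<) r" "distinct r"
        by (auto simp: r_def)
      have mset: "mset (s # c # r) = mset w'"
        using s c r dist \<open>s < x\<close> by (subst set_eq_iff_mset_eq_distinct[symmetric]) auto
      then have "length w' = length r + 2" using mset_eq_length by fastforce
      \<comment> \<open>No letter of \<open>w'\<close> lies strictly between \<open>x\<close> and
        \<open>c\<close>, and \<open>s\<close> lies below \<open>x\<close>.\<close>
      have "y = c \<or> y \<in> set r \<and> c < y \<longleftrightarrow> y \<in> set w' \<and> x < y" for y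
        using c c_le[of y] \<open>s < x\<close> unfolding r(1) by (cases "y = c") auto
      then have "{y \<in> set w'. x < y} = insert c {y \<in> set r. c < y}"
        by blast
      then have "card {y \<in> set w'. x < y} = Suc (card {y \<in> set r. c < y})" by simp
      \<comment> \<open>From \<open>w'\<close> to \<open>r\<close> the length drops by two and the
        count of larger letters by one, so the condition on \<open>x\<close> becomes the one on
        \<open>c\<close>.\<close>
      with len \<open>length w' = length r + 2\<close> r have "half_dominated (c # r)"
        by (simp add: half_dominated_sorted)
      with c \<open>s < x\<close> have hd: "half_dominated (x # c # r)" "half_dominated (s # c # r)"
        using half_dominated_head_swap[of c r s x] half_dominated_head_swap[of c r x s] by auto
      have "distinct (s # c # r)"
        using mset dist mset_eq_imp_distinct_iff by blast
      have "sort w' = sort (s # c # r)"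
        by (rule properties_for_sort) (use mset in \<open>simp_all only: mset_sort sorted_sort\<close>)
      with w' have "w' \<approx> sort (s # c # r)" by (simp only:)
      \<comment> \<open>The induction hypothesis is used backwards, to unsort the tail so that
        \<open>c\<close> stands next to \<open>s\<close>.\<close>
      also have "sort (s # c # r) \<approx> s # c # r"
        using hd \<open>distinct (s # c # r)\<close> \<open>length w' = length r + 2\<close> Cons
        by (intro adjacent_equiv_sym[OF IH]) auto
      finally have "x # w' \<approx> x # s # c # r" by (rule adjacent_equiv_Cons)
      \<comment> \<open>The only explicit move: \<open>c\<close> is larger than both
        \<open>x\<close> and \<open>s\<close>.\<close>
      also have "x # s # c # r \<approx> s # x # c # r"
        using moveI[of x s c "[]" r] c \<open>s < x\<close> by (intro adjacent_move_imp_equiv) simp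
      also have "s # x # c # r \<approx> s # sort (x # c # r)"
        using hd dist r c \<open>length w' = length r + 2\<close> Cons
        by (intro adjacent_equiv_Cons[OF IH]) auto
      also have "s # sort (x # c # r) = sort w"
      proof (rule properties_for_sort[symmetric])
        show "mset (s # sort (x # c # r)) = mset w"
          using mset by (simp add: Cons add_mset_commute)
        have "\<forall>y \<in> set (x # c # r). s \<le> y"
          using s_le c r \<open>s < x\<close> by auto
        then show "sorted (s # sort (x # c # r))"
          by (simp only: sorted_simps(2) set_sort sorted_sort simp_thms)
      qed
      finally show ?thesis by (simp only: Cons)
    qed
  qed
qed

section \<open>Counting half-dominated words\<close>

text \<open>Counting the larger elements ranks \<open>A\<close> bijectively onto the numbers below
  \<open>card A\<close>, so it suffices to count the ranks that are large enough.\<close>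

lemma card_half_dominated_heads:
  fixes A :: "nat set"
  assumes "finite A"
  shows "card {x \<in> A. card A - 1 \<le> 2 * card {y \<in> A. x < y}} = (card A + 1) div 2"
proof -
  define g where "g x = card {y \<in> A. x < y}" for x
  have less: "g y < g x" if "x \<in> A" "y \<in> A" "x < y" for x y
    unfolding g_def using that assms by (intro psubset_card_mono) auto
  then have inj: "inj_on g A"
    by (metis inj_onI linorder_neqE_nat less_irrefl_nat)
  have "g x < card A" if "x \<in> A" for x
    unfolding g_def using that assms by (intro psubset_card_mono) auto
  then have im: "g ` A = {..<card A}"
    using inj by (intro card_subset_eq) (auto simp: card_image)
  have "card {x \<in> A. card A - 1 \<le> 2 * g x} = card (g ` {x \<in> A. card A - 1 \<le> 2 * g x})"
    using inj by (intro card_image[symmetric]) (auto simp: inj_on_def)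
  also have "g ` {x \<in> A. card A - 1 \<le> 2 * g x} = {j \<in> g ` A. card A - 1 \<le> 2 * j}"
    by auto
  \<comment> \<open>For either parity of \<open>card A\<close>, the least \<open>j\<close> with
    \<open>card A - 1 \<le> 2 * j\<close> is \<open>card A div 2\<close>.\<close>
  also have "\<dots> = {card A div 2..<card A}"
    unfolding im by auto
  finally show ?thesis by (simp add: g_def)
qed

text \<open>A half-dominated word on \<open>A\<close> is an admissible head \<open>x\<close> in
  \<open>H\<close> followed by any half-dominated word on \<open>A - {x}\<close>; the number of
  tails depends only on the size of \<open>A\<close>.\<close>

lemma card_half_dominated:
  fixes A :: "nat set"
  assumes "finite A"
  shows "card {w \<in> permutations_of_set A. half_dominated w}
         = fact (card A div 2) * fact ((card A + 1) div 2)"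
  using assms
proof (induction "card A" arbitrary: A)
  case 0
  then have "{w \<in> permutations_of_set A. half_dominated w} = {[]}" by auto
  with 0 show ?case by simp
next
  case (Suc n)
  define H where "H = {x \<in> A. card A - 1 \<le> 2 * card {y \<in> A. x < y}}"
  define F where "F x = {w \<in> permutations_of_set (A - {x}). half_dominated w}" for x
  have fin: "finite A" "finite H" and sub: "H \<subseteq> A" using Suc by (auto simp: H_def)
  have "A \<noteq> {}" using Suc by auto
  have gr: "{y \<in> A. x < y} = {y \<in> A - {x}. x < y}" for x by auto
  have len: "length w = card A - 1 \<and> set w = A - {x}"
    if "x \<in> A" "w \<in> permutations_of_set (A - {x})" for x w
    using that fin length_finite_permutations_of_set[OF that(2)] permutations_of_setD[OF that(2)]
    by simp
  have "{w \<in> permutations_of_set A. half_dominated w} = (\<Union>x\<in>H. (#) x ` F x)"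
    unfolding permutations_of_set_nonempty[OF \<open>A \<noteq> {}\<close>] H_def F_def gr
    using len by fastforce
  also have "card \<dots> = (\<Sum>x\<in>H. card ((#) x ` F x))"
    using fin by (intro card_UN_disjoint) (auto simp: F_def)
  also have "\<dots> = (\<Sum>x\<in>H. fact (n div 2) * fact ((n + 1) div 2))"
  proof (rule sum.cong)
    fix x assume "x \<in> H"
    then have "n = card (A - {x})" using Suc sub by auto
    with Suc.hyps(1)[OF this] fin
    show "card ((#) x ` F x) = fact (n div 2) * fact ((n + 1) div 2)"
      by (simp add: F_def card_image)
  qed simp
  also have "\<dots> = (n div 2 + 1) * (fact (n div 2) * fact ((n + 1) div 2))"
    using card_half_dominated_heads[OF fin(1)] Suc.hyps(2)[symmetric] by (simp add: H_def)
  \<comment> \<open>The new factor extends \<open>fact (n div 2)\<close>, while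
    \<open>(n + 1) div 2\<close> is already \<open>Suc n div 2\<close>: the two factorials exchange
    roles.\<close>
  also have "\<dots> = fact (Suc n div 2) * fact (n div 2 + 1)"
    by (simp add: algebra_simps)
  finally show ?case using Suc.hyps(2)[symmetric] by simp
qed

theorem theorem3p1:
  fixes n :: nat
  assumes "n \<ge> 1"
  shows "card {\<pi> \<in> permutations_of_set {1..n}.
            adjacent_equiv {{[1, 2, 3], [2, 1, 3]}} [1..<n + 1] \<pi>}
         = fact (nat \<lfloor>real n / 2\<rfloor>) * fact (nat \<lceil>real n / 2\<rceil>)"
proof -
  have "[1..<n + 1] \<approx> \<pi> \<longleftrightarrow> half_dominated \<pi>" if "\<pi> \<in> permutations_of_set {1..n}" for \<pi>
  proof
    assume "[1..<n + 1] \<approx> \<pi>"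
    then show "half_dominated \<pi>"
      using half_dominated_equiv half_dominated_sorted sorted_wrt_upt by blast
  next
    assume dom: "half_dominated \<pi>"
    have \<pi>: "distinct \<pi>" "set \<pi> = {1..n}"
      using that by (auto simp: permutations_of_set_def)
    \<comment> \<open>The sorted form of a distinct word depends only on its set of letters, here
      that of the identity.\<close>
    have "sort \<pi> = [1..<n + 1]"
      using \<pi> sorted_list_of_set_sort_remdups[of \<pi>] sorted_list_of_set_range[of 1 "n + 1"]
      by (simp add: distinct_remdups_id atLeastLessThanSuc_atLeastAtMost del: upt_Suc)
    with equiv_sort[OF dom \<pi>(1)] show "[1..<n + 1] \<approx> \<pi>"
      by (metis adjacent_equiv_sym)
  qed
  then have "{\<pi> \<in> permutations_of_set {1..n}. [1..<n + 1] \<approx> \<pi>}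
           = {\<pi> \<in> permutations_of_set {1..n}. half_dominated \<pi>}"
    by blast
  moreover have "nat \<lfloor>real n / 2\<rfloor> = n div 2"
    by linarith
  moreover have "nat \<lceil>real n / 2\<rceil> = (n + 1) div 2"
    by linarith
  ultimately show ?thesis
    by (simp add: card_half_dominated)
qed

end
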